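(* Let $d>0$. Let $J:\mathbb{R}\to[0,\infty)$ be continuous with $\int_{\mathbb{R}}J(x)\,dx=1$, and let $u_0\in\mathscr{S}'(\mathbb{R})$ be a tempered distribution with $\hat u_0\in L^1(\mathbb{R})$. Let $u(t,x)$ denote the solution of $$u_t(t,x)=d\,(J*u)(t,x)-u(t,x),\quad t>0,\ x\in\mathbb{R},\qquad u(0,x)=u_0(x),\quad x\in\mathbb{R}.$$ Then for all $t>0$ and $x\in\mathbb{R}$, $$|u(t,x)|\le \|\hat u_0\|_{L^1(\mathbb{R})}\,e^{(d-1)t}.$$ Furthermore, the rate $e^{(d-1)t}$ is sharp in the following sense: for any $\varepsilon>0$ there are $J$ and $u_0$ (satisfying the hypotheses above) such that the corresponding solution $u$ satisfies, for all $t>0$ and $x\in\mathbb{R}$, $$g(x)\,e^{(d-1-\varepsilon)t}<|u(t,x)|<h(x)\,e^{(d-1)t},$$ where $g,h:\mathbb{R}\to(0,\infty)$ are functions determined only by $u_0$ (that is, there is an assignment $u_0\mapsto(g,h)=(g_{u_0},h_{u_0})$, not depending on $t$, $J$, $d$ or $\varepsilon$, for which this holds).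
   Context: The convolution is in the space variable: $(J*u)(t,x)=\int_{\mathbb{R}}J(x-y)u(t,y)\,dy$. The Fourier transform and inverse Fourier transform of $f\in L^1(\mathbb{R})$ are $\hat f(\xi)=\int_{\mathbb{R}}f(x)e^{-2\pi i x\xi}\,dx$ and $\check f(x)=\int_{\mathbb{R}}f(\xi)e^{2\pi i x\xi}\,d\xi$, and they are extended to $\mathscr{S}'(\mathbb{R})$ by duality: $\langle\hat f,\varphi\rangle=\langle f,\hat\varphi\rangle$, $\langle\check f,\varphi\rangle=\langle f,\check\varphi\rangle$ for all $\varphi\in\mathscr{S}(\mathbb{R})$. The condition $\hat u_0\in L^1(\mathbb{R})$ means that the distribution $\hat u_0$ is given by an $L^1$ function; then $u_0$ is identified with the bounded continuous function $(\hat u_0)\check{\ }$. The solution of the initial value problem is understood as the one obtained by Fourier transform in $x$: its spatial Fourier transform is $\hat u(t,\xi)=e^{t(d\hat J(\xi)-1)}\hat u_0(\xi)\in L^1(\mathbb{R})$, i.e. $$u(t,x)=\int_{\mathbb{R}}e^{t(d\hat J(\xi)-1)}\,\hat u_0(\xi)\,e^{2\pi i x\xi}\,d\xi .$$ *)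

theory Defs
  imports "HOL-Analysis.Analysis"
begin

definition fourier :: "(real \<Rightarrow> complex) \<Rightarrow> real \<Rightarrow> complex" where
  "fourier f \<xi> = (LINT x|lborel. f x * exp (- 2 * pi * \<i> * x * \<xi>))"

definition inv_fourier :: "(real \<Rightarrow> complex) \<Rightarrow> real \<Rightarrow> complex" where
  "inv_fourier f x = (LINT \<xi>|lborel. f \<xi> * exp (2 * pi * \<i> * x * \<xi>))"

definition nderiv :: "nat \<Rightarrow> (real \<Rightarrow> complex) \<Rightarrow> real \<Rightarrow> complex" where
  "nderiv k = (\<lambda>\<phi> x. vector_derivative \<phi> (at x)) ^^ k"

definition schwartz :: "(real \<Rightarrow> complex) set" where
  "schwartz = {\<phi>. (\<forall>k x. nderiv k \<phi> differentiable (at x)) \<and>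
                   (\<forall>m k. bounded (range (\<lambda>x. x ^ m *\<^sub>R nderiv k \<phi> x)))}"

definition schwartz_tendsto :: "(nat \<Rightarrow> real \<Rightarrow> complex) \<Rightarrow> (real \<Rightarrow> complex) \<Rightarrow> bool" where
  "schwartz_tendsto \<Phi> \<phi> \<longleftrightarrow>
     (\<forall>m k. uniform_limit UNIV (\<lambda>n x. x ^ m *\<^sub>R nderiv k (\<Phi> n) x)
                               (\<lambda>x. x ^ m *\<^sub>R nderiv k \<phi> x) sequentially)"

type_synonym functional = "(real \<Rightarrow> complex) \<Rightarrow> complex"

text \<open>
  A distribution is a functional of which only the values on \<^const>\<open>schwartz\<close> matter;
  \<open>dist_eq\<close> is equality of distributions. The topology of the Schwartz space is metrizable,
  so sequential continuity is continuity.
\<close>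

definition tempered_distribution :: "functional \<Rightarrow> bool" where
  "tempered_distribution T \<longleftrightarrow>
     (\<forall>\<phi>\<in>schwartz. \<forall>\<psi>\<in>schwartz. T (\<lambda>x. \<phi> x + \<psi> x) = T \<phi> + T \<psi>) \<and>
     (\<forall>c. \<forall>\<phi>\<in>schwartz. T (\<lambda>x. c * \<phi> x) = c * T \<phi>) \<and>
     (\<forall>\<Phi>. \<forall>\<phi>\<in>schwartz. (\<forall>n. \<Phi> n \<in> schwartz) \<longrightarrow> schwartz_tendsto \<Phi> \<phi> \<longrightarrow>
        (\<lambda>n. T (\<Phi> n)) \<longlonglongrightarrow> T \<phi>)"

definition dist_eq :: "functional \<Rightarrow> functional \<Rightarrow> bool" where
  "dist_eq S T \<longleftrightarrow> (\<forall>\<phi>\<in>schwartz. S \<phi> = T \<phi>)"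

definition dist_fourier :: "functional \<Rightarrow> functional" where
  "dist_fourier T = (\<lambda>\<phi>. T (fourier \<phi>))"

definition dist_of_fun :: "(real \<Rightarrow> complex) \<Rightarrow> functional" where
  "dist_of_fun f = (\<lambda>\<phi>. LINT x|lborel. f x * \<phi> x)"

text \<open>
  The distribution \<open>u0\<close> is tempered and its Fourier transform is given by the integrable
  function \<open>f\<close>, which \<open>u0\<close> determines up to a null set.
\<close>

definition has_L1_fourier :: "functional \<Rightarrow> (real \<Rightarrow> complex) \<Rightarrow> bool" where
  "has_L1_fourier u0 f \<longleftrightarrow>
     tempered_distribution u0 \<and> integrable lborel f \<and> dist_eq (dist_fourier u0) (dist_of_fun f)"

definition L1_norm :: "(real \<Rightarrow> complex) \<Rightarrow> real" where
  "L1_norm f = (LINT x|lborel. norm (f x))"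

definition prob_kernel :: "(real \<Rightarrow> real) \<Rightarrow> bool" where
  "prob_kernel J \<longleftrightarrow> continuous_on UNIV J \<and> (\<forall>x. 0 \<le> J x) \<and> has_bochner_integral lborel J 1"

text \<open>
  The solution of \<open>u\<^sub>t = d (J * u) - u\<close>, \<open>u(0) = u0\<close> obtained by Fourier transform in
  the space variable, as a function of the Fourier transform \<open>u0_hat\<close> of the initial value:
  in frequency space the problem is, for each \<open>\<xi>\<close>, a linear ODE with coefficient
  \<open>d * fourier J \<xi> - 1\<close>.
\<close>

definition solution_hat ::
  "real \<Rightarrow> (real \<Rightarrow> real) \<Rightarrow> (real \<Rightarrow> complex) \<Rightarrow> real \<Rightarrow> real \<Rightarrow> complex" where
  "solution_hat d J u0_hat t \<xi> = exp (t * (d * fourier (\<lambda>x. of_real (J x)) \<xi> - 1)) * u0_hat \<xi>"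

definition solution ::
  "real \<Rightarrow> (real \<Rightarrow> real) \<Rightarrow> (real \<Rightarrow> complex) \<Rightarrow> real \<Rightarrow> real \<Rightarrow> complex" where
  "solution d J u0_hat t = inv_fourier (solution_hat d J u0_hat t)"

end

theory Submission
  imports Defs "HOL-Probability.Characteristic_Functions" "HOL-Probability.Sinc_Integral"
begin

text \<open>
  The upper bound holds because \<open>Re (fourier J \<xi>) \<le> 1\<close>. For sharpness take
  \<open>u0 = fourier u0 = exp (- pi * x\<^sup>2)\<close> and the Gaussian kernel \<open>J\<close> with Fourier transform
  \<open>exp (- pi * s * \<xi>\<^sup>2)\<close>. Since the \<open>n\<close>-fold convolution of \<open>J\<close> with \<open>u0\<close> is
  \<open>(1 + n * s) powr (- 1 / 2) * exp (- pi * x\<^sup>2 / (1 + n * s))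
  \<ge> exp (- n * s / 2) * exp (- pi * x\<^sup>2)\<close>, the exponential series gives
  \<open>u t x \<ge> exp (- pi * x\<^sup>2) * exp ((d * exp (- s / 2) - 1) * t)\<close>, and
  \<open>d * exp (- s / 2) \<ge> d - \<epsilon>\<close> for \<open>s = 2 * \<epsilon> / d\<close>. The functions
  \<open>g x = exp (- pi * x\<^sup>2) / 2\<close> and \<open>h x = 2\<close> then serve for every initial value.
\<close>

subsection \<open>Gaussians\<close>

definition gaussian :: "real \<Rightarrow> real \<Rightarrow> real" where
  "gaussian a x = exp (- pi * a * x\<^sup>2)"

lemma gaussian_pos [simp]: "0 < gaussian a x"
  by (simp add: gaussian_def)

text \<open>Gives access to the moments and the characteristic function of the standard normal law.
  The summand \<open>0\<close> matches the affine form \<open>t + c * x\<close> of the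
  change-of-variables rules for \<open>lborel\<close>.\<close>

lemma gaussian_conv_std_normal_density:
  assumes "0 < a"
  shows "gaussian a x = sqrt (2 * pi) * std_normal_density (0 + sqrt (2 * pi * a) * x)"
  using assms by (simp add: gaussian_def std_normal_density_def power_mult_distrib)

lemma integrable_gaussian:
  assumes "0 < a"
  shows "integrable lborel (gaussian a)"
proof -
  have "integrable lborel std_normal_density"
    using integrable_std_normal_moment [of 0] by simp
  then have "integrable lborel (\<lambda>x. std_normal_density (0 + sqrt (2 * pi * a) * x))"
    using assms by (intro lborel_integrable_real_affine) auto
  then show ?thesis
    unfolding gaussian_conv_std_normal_density [OF assms, abs_def] by simp
qed

text \<open>The substitution \<open>y = c * \<xi>\<close> turns this integral into the
  characteristic function of the standard normal law, which is
  \<open>exp (- s\<^sup>2 / 2)\<close>.\<close>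

lemma inv_fourier_gaussian:
  assumes "0 < a"
  shows "inv_fourier (\<lambda>\<xi>. of_real (gaussian a \<xi>)) x
    = of_real (gaussian (inverse a) x / sqrt a)"
proof -
  define c where "c = sqrt (2 * pi * a)"
  \<comment> \<open>The argument of the characteristic function for which the phase
    \<open>s * y\<close> becomes \<open>2 * pi * x * \<xi>\<close> under
    \<open>y = c * \<xi>\<close>.\<close>
  define s where "s = 2 * pi * x / c"
  have c: "0 < c" "s * c = 2 * pi * x" "c = sqrt (2 * pi) * sqrt a"
    using assms by (simp_all add: c_def s_def) (simp add: real_sqrt_mult)
  have s2: "s\<^sup>2 / 2 = pi * inverse a * x\<^sup>2"
    using assms by (simp add: s_def c_def power_divide power_mult_distrib) (simp add: field_simps power2_eq_square)
  have "complex_of_real (exp (- s\<^sup>2 / 2)) = char std_normal_distribution s"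
    by (simp add: char_std_normal_distribution)
  also have "\<dots> = (LINT y|lborel. std_normal_density y *\<^sub>R iexp (s * y))"
    by (simp add: char_def integral_density)
  also have "\<dots> = \<bar>c\<bar> *\<^sub>R (LINT \<xi>|lborel. std_normal_density (0 + c * \<xi>) *\<^sub>R iexp (s * (0 + c * \<xi>)))"
    using c(1) by (intro lborel_integral_real_affine) simp
  also have "(\<lambda>\<xi>. std_normal_density (0 + c * \<xi>) *\<^sub>R iexp (s * (0 + c * \<xi>)))
    = (\<lambda>\<xi>. of_real (1 / sqrt (2 * pi)) * (of_real (gaussian a \<xi>) * exp (2 * pi * \<i> * x * \<xi>)))"
  proof
    fix \<xi>
    have "s * (0 + c * \<xi>) = 2 * pi * x * \<xi>"
      using c(2) by (simp add: mult.assoc [symmetric])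
    then have "iexp (s * (0 + c * \<xi>)) = exp (2 * pi * \<i> * x * \<xi>)"
      by (simp only: \<open>s * (0 + c * \<xi>) = 2 * pi * x * \<xi>\<close>) (simp add: mult_ac)
    moreover have "std_normal_density (0 + c * \<xi>) = 1 / sqrt (2 * pi) * gaussian a \<xi>"
      by (simp add: gaussian_conv_std_normal_density [OF assms] c_def)
    ultimately show "std_normal_density (0 + c * \<xi>) *\<^sub>R iexp (s * (0 + c * \<xi>))
      = of_real (1 / sqrt (2 * pi)) * (of_real (gaussian a \<xi>) * exp (2 * pi * \<i> * x * \<xi>))"
      by (simp only: scaleR_conv_of_real of_real_mult mult.assoc)
  qed
  also have "\<bar>c\<bar> *\<^sub>R (LINT \<xi>|lborel. of_real (1 / sqrt (2 * pi)) *
      (of_real (gaussian a \<xi>) * exp (2 * pi * \<i> * x * \<xi>)))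
    = of_real (sqrt a) * inv_fourier (\<lambda>\<xi>. of_real (gaussian a \<xi>)) x"
    unfolding inv_fourier_def using c(1) by (simp add: scaleR_conv_of_real c(3))
  finally show ?thesis
    using assms s2 by (simp add: gaussian_def field_simps)
qed

lemma fourier_conv_inv_fourier: "fourier f \<xi> = inv_fourier f (- \<xi>)"
  by (simp add: fourier_def inv_fourier_def mult_ac)

text \<open>At the point 0 the inverse Fourier transform is the plain integral.\<close>

lemma integral_gaussian:
  assumes "0 < a"
  shows "(LINT x|lborel. gaussian a x) = 1 / sqrt a"
proof -
  have "complex_of_real (LINT x|lborel. gaussian a x) = of_real (1 / sqrt a)"
    using inv_fourier_gaussian [OF assms, of 0] by (simp add: inv_fourier_def gaussian_def)
  then show ?thesis
    by (simp only: of_real_eq_iff)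
qed

text \<open>The normal density with mean 0 and variance \<open>s / (2 * pi)\<close>, parametrized so
  that its Fourier transform is \<open>gaussian s\<close>.\<close>

definition gaussian_kernel :: "real \<Rightarrow> real \<Rightarrow> real" where
  "gaussian_kernel s x = gaussian (inverse s) x / sqrt s"

lemma prob_kernel_gaussian_kernel:
  assumes "0 < s"
  shows "prob_kernel (gaussian_kernel s)"
  unfolding prob_kernel_def
proof (intro conjI allI)
  show "continuous_on UNIV (gaussian_kernel s)"
    unfolding gaussian_kernel_def [abs_def] gaussian_def
    using assms by (intro continuous_intros) auto
  show "0 \<le> gaussian_kernel s x" for x
    using assms by (simp add: gaussian_kernel_def less_imp_le)
  have "(LINT x|lborel. gaussian_kernel s x) = 1"
    using assms by (simp add: gaussian_kernel_def integral_gaussian real_sqrt_inverse)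
  moreover have "integrable lborel (gaussian_kernel s)"
    unfolding gaussian_kernel_def [abs_def] using assms by (simp add: integrable_gaussian)
  ultimately show "has_bochner_integral lborel (gaussian_kernel s) 1"
    by (simp add: has_bochner_integral_iff)
qed

text \<open>Apply \<open>inv_fourier_gaussian\<close> with parameter \<open>inverse s\<close> at
  \<open>- \<xi>\<close>: the Gaussian is even, and the factor \<open>sqrt s\<close> that arises
  cancels the normalization of the kernel.\<close>

lemma fourier_gaussian_kernel:
  assumes "0 < s"
  shows "fourier (\<lambda>x. of_real (gaussian_kernel s x)) \<xi> = of_real (gaussian s \<xi>)"
proof -
  have "fourier (\<lambda>x. of_real (gaussian_kernel s x)) \<xi>
    = fourier (\<lambda>x. of_real (gaussian (inverse s) x)) \<xi> / of_real (sqrt s)"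
    by (simp add: fourier_def gaussian_kernel_def)
  then show ?thesis
    using assms inv_fourier_gaussian [of "inverse s" "- \<xi>"]
    by (simp add: fourier_conv_inv_fourier gaussian_def real_sqrt_inverse)
qed

subsection \<open>Integrable functions as tempered distributions\<close>

lemma schwartz_continuous:
  assumes "\<phi> \<in> schwartz"
  shows "continuous_on UNIV \<phi>"
proof -
  have "nderiv 0 \<phi> differentiable (at x)" for x
    using assms unfolding schwartz_def by blast
  then show ?thesis
    by (auto simp: nderiv_def differentiable_on_def intro!: differentiable_imp_continuous_on)
qed

lemma schwartz_measurable:
  assumes "\<phi> \<in> schwartz"
  shows "\<phi> \<in> borel_measurable lborel"
  using borel_measurable_continuous_onI [OF schwartz_continuous [OF assms]] by simp

text \<open>The case \<open>m = 0\<close> yields boundedness of a test function, and together with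
  \<open>m = 2\<close> its integrability.\<close>

lemma schwartz_power_bounded:
  assumes "\<phi> \<in> schwartz"
  obtains B where "\<And>x. \<bar>x\<bar> ^ m * norm (\<phi> x) \<le> B"
proof -
  have "bounded (range (\<lambda>x. x ^ m *\<^sub>R nderiv 0 \<phi> x))"
    using assms unfolding schwartz_def by blast
  then show ?thesis
    using that by (auto simp: bounded_iff nderiv_def power_abs)
qed

lemma integrable_mult_bounded:
  fixes f \<phi> :: "real \<Rightarrow> complex"
  assumes f: "integrable lborel f" and \<phi>: "\<phi> \<in> borel_measurable lborel"
    and B: "\<And>x. norm (\<phi> x) \<le> B"
  shows "integrable lborel (\<lambda>x. f x * \<phi> x)"
proof (rule Bochner_Integration.integrable_bound)
  show "integrable lborel (\<lambda>x. of_real B * f x)"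
    using f by simp
  show "(\<lambda>x. f x * \<phi> x) \<in> borel_measurable lborel"
    using f \<phi> by measurable
  show "AE x in lborel. norm (f x * \<phi> x) \<le> norm (of_real B * f x)"
  proof (rule AE_I2)
    fix x
    have "norm (\<phi> x) \<le> \<bar>B\<bar>"
      using B [of x] by simp
    then show "norm (f x * \<phi> x) \<le> norm (of_real B * f x)"
      by (simp add: norm_mult mult.commute [of "norm (f x)"] mult_right_mono)
  qed
qed

lemma integrable_mult_schwartz:
  assumes "integrable lborel f" and \<phi>: "\<phi> \<in> schwartz"
  shows "integrable lborel (\<lambda>x. f x * \<phi> x)"
proof -
  obtain B where "\<And>x. norm (\<phi> x) \<le> B"
    using schwartz_power_bounded [OF \<phi>, of 0] by auto
  with assms show ?thesis
    by (intro integrable_mult_bounded schwartz_measurable)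
qed

text \<open>Adding the bounds for \<open>\<phi>\<close> and \<open>x\<^sup>2 * \<phi>\<close> gives
  a multiple of \<open>1 / (1 + x\<^sup>2)\<close> as integrable majorant.\<close>

lemma schwartz_integrable:
  assumes \<phi>: "\<phi> \<in> schwartz"
  shows "integrable lborel \<phi>"
proof -
  obtain B where B: "\<And>x. norm (\<phi> x) \<le> B"
    using schwartz_power_bounded [OF \<phi>, of 0] by auto
  obtain C where C: "\<And>x. \<bar>x\<bar> ^ 2 * norm (\<phi> x) \<le> C"
    using schwartz_power_bounded [OF \<phi>, of 2] by blast
  show ?thesis
  proof (rule Bochner_Integration.integrable_bound)
    show "integrable lborel (\<lambda>x. (B + C) * inverse (1 + x\<^sup>2))"
      using integrable_inverse_1_plus_square
      by (simp add: set_integrable_def)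
    show "\<phi> \<in> borel_measurable lborel"
      using \<phi> by (rule schwartz_measurable)
    show "AE x in lborel. norm (\<phi> x) \<le> norm ((B + C) * inverse (1 + x\<^sup>2))"
    proof (rule AE_I2)
      fix x :: real
      have "0 < 1 + x\<^sup>2"
        by (simp add: add_pos_nonneg)
      moreover have "(1 + x\<^sup>2) * norm (\<phi> x) \<le> B + C"
        using B [of x] C [of x] by (simp add: distrib_right)
      ultimately have "norm (\<phi> x) \<le> (B + C) * inverse (1 + x\<^sup>2)"
        by (simp add: field_simps)
      then show "norm (\<phi> x) \<le> norm ((B + C) * inverse (1 + x\<^sup>2))"
        by simp
    qed
  qed
qed

text \<open>Convergence in the Schwartz space implies uniform convergence
  (\<open>m = k = 0\<close>), and pairing with an integrable function is continuous in the supremum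
  norm.\<close>

lemma tempered_distribution_dist_of_fun:
  assumes f: "integrable lborel f"
  shows "tempered_distribution (dist_of_fun f)"
  unfolding tempered_distribution_def
proof (intro conjI ballI allI impI)
  fix \<phi> \<psi> assume "\<phi> \<in> schwartz" "\<psi> \<in> schwartz"
  then show "dist_of_fun f (\<lambda>x. \<phi> x + \<psi> x) = dist_of_fun f \<phi> + dist_of_fun f \<psi>"
    by (simp add: dist_of_fun_def distrib_left integrable_mult_schwartz [OF f])
next
  fix c \<phi> assume "\<phi> \<in> schwartz"
  show "dist_of_fun f (\<lambda>x. c * \<phi> x) = c * dist_of_fun f \<phi>"
    by (simp add: dist_of_fun_def mult.left_commute)
next
  fix \<Phi> \<phi>
  assume \<phi>: "\<phi> \<in> schwartz" and \<Phi>: "\<forall>n. \<Phi> n \<in> schwartz" and lim: "schwartz_tendsto \<Phi> \<phi>"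
  have "uniform_limit UNIV (\<lambda>n x. x ^ 0 *\<^sub>R nderiv 0 (\<Phi> n) x) (\<lambda>x. x ^ 0 *\<^sub>R nderiv 0 \<phi> x) sequentially"
    using lim unfolding schwartz_tendsto_def by blast
  then have unif: "uniform_limit UNIV \<Phi> \<phi> sequentially"
    by (simp add: nderiv_def)
  \<comment> \<open>The added 1 keeps \<open>e / N\<close> meaningful when \<open>f\<close> vanishes
    almost everywhere, and makes the final estimate strict.\<close>
  define N where "N = L1_norm f + 1"
  have N: "0 < N" "L1_norm f < N"
    by (simp_all add: N_def L1_norm_def add_nonneg_pos)
  show "(\<lambda>n. dist_of_fun f (\<Phi> n)) \<longlonglongrightarrow> dist_of_fun f \<phi>"
  proof (rule tendstoI)
    fix e :: real assume e: "0 < e"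
    have "\<forall>\<^sub>F n in sequentially. \<forall>x\<in>UNIV. dist (\<Phi> n x) (\<phi> x) < e / N"
      using uniform_limitD [OF unif, of "e / N"] e N by simp
    then show "\<forall>\<^sub>F n in sequentially. dist (dist_of_fun f (\<Phi> n)) (dist_of_fun f \<phi>) < e"
    proof eventually_elim
      case (elim n)
      have "dist_of_fun f (\<Phi> n) - dist_of_fun f \<phi> = (LINT x|lborel. f x * (\<Phi> n x - \<phi> x))"
        using \<phi> \<Phi> by (simp add: dist_of_fun_def integrable_mult_schwartz [OF f] right_diff_distrib)
      also have "norm \<dots> \<le> (LINT x|lborel. norm (f x * (\<Phi> n x - \<phi> x)))"
        by (rule integral_norm_bound)
      also have "\<dots> \<le> (LINT x|lborel. norm (f x) * (e / N))"
        using f e N elim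
        by (intro integral_mono') (auto simp: norm_mult dist_norm less_imp_le simp del: times_divide_eq_right intro!: mult_left_mono)
      also have "\<dots> = L1_norm f * (e / N)"
        by (simp add: L1_norm_def)
      also have "\<dots> < N * (e / N)"
        using N e by (intro mult_strict_right_mono) auto
      finally show ?case
        using N by (simp add: dist_norm)
    qed
  qed
qed

text \<open>Both sides are iterated integrals of \<open>f x * \<phi> y\<close> times a character
  that is symmetric in \<open>x\<close> and \<open>y\<close>. The character has modulus 1, so
  Fubini's theorem applies.\<close>

lemma integral_mult_fourier:
  assumes f: "integrable lborel f" and \<phi>: "integrable lborel \<phi>"
  shows "(LINT x|lborel. f x * fourier \<phi> x) = (LINT x|lborel. fourier f x * \<phi> x)"
proof -
  let ?e = "\<lambda>x y. exp (- 2 * pi * \<i> * complex_of_real x * complex_of_real y)"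
  have [measurable]: "f \<in> borel_measurable borel" "\<phi> \<in> borel_measurable borel"
    using f \<phi> by auto
  have norm_e: "norm (?e x y) = 1" for x y
    by (simp add: norm_exp_eq_Re)
  have "integrable (lborel \<Otimes>\<^sub>M lborel) (\<lambda>(x, y). f x * \<phi> y * ?e y x)"
  proof (rule lborel_pair.Fubini_integrable)
    show "integrable lborel (\<lambda>x. LINT y|lborel. norm (case (x, y) of (x, y) \<Rightarrow> f x * \<phi> y * ?e y x))"
      using f by (simp only: prod.case norm_mult norm_e) simp
    have "integrable lborel (\<lambda>y. \<phi> y * ?e y x)" for x
    proof (rule integrable_mult_bounded [OF \<phi>])
      show "(\<lambda>y. ?e y x) \<in> borel_measurable lborel"
        by measurable
      show "norm (?e y x) \<le> 1" for y
        by (simp only: norm_e order_refl)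
    qed
    then show "AE x in lborel. integrable lborel (\<lambda>y. case (x, y) of (x, y) \<Rightarrow> f x * \<phi> y * ?e y x)"
      by (simp add: mult.assoc)
  qed measurable
  from lborel_pair.Fubini_integral [OF this]
  show ?thesis
    by (simp add: fourier_def mult_ac flip: integral_mult_right_zero integral_mult_left_zero)
qed

text \<open>By the multiplication formula against test functions, the Fourier transform defined by
  duality agrees with the one defined by the integral.\<close>

lemma has_L1_fourier_dist_of_fun:
  assumes f: "integrable lborel f" and "integrable lborel (fourier f)"
  shows "has_L1_fourier (dist_of_fun f) (fourier f)"
  using assms integral_mult_fourier [OF f schwartz_integrable]
  by (auto simp: has_L1_fourier_def dist_eq_def dist_fourier_def dist_of_fun_def
      tempered_distribution_dist_of_fun [unfolded dist_of_fun_def])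

subsection \<open>Bounds for the solution\<close>

lemma norm_exp_character: "norm (exp (2 * pi * \<i> * complex_of_real x * complex_of_real y)) = 1"
  by (simp add: norm_exp_eq_Re)

lemma norm_fourier_prob_kernel_le:
  assumes "prob_kernel J"
  shows "norm (fourier (\<lambda>x. of_real (J x)) \<xi>) \<le> 1"
proof -
  have "norm (fourier (\<lambda>x. of_real (J x)) \<xi>)
    \<le> (LINT x|lborel. norm (of_real (J x) * exp (- 2 * pi * \<i> * x * \<xi>)))"
    unfolding fourier_def by (rule integral_norm_bound)
  also have "\<dots> = (LINT x|lborel. J x)"
    using assms by (simp add: norm_mult norm_exp_eq_Re prob_kernel_def)
  finally show ?thesis
    using assms by (simp add: prob_kernel_def has_bochner_integral_iff)
qed

text \<open>The frequency \<open>\<xi>\<close> grows at the rate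
  \<open>d * Re (fourier J \<xi>) - 1\<close>, which is at most \<open>d - 1\<close>. Integrating
  over all frequencies gives the \<open>L1_norm\<close>.\<close>

lemma norm_solution_le:
  assumes d: "d \<ge> 0" and J: "prob_kernel J" and f: "integrable lborel f" and t: "t \<ge> 0"
  shows "norm (solution d J f t x) \<le> L1_norm f * exp ((d - 1) * t)"
proof -
  have "norm (solution_hat d J f t \<xi>) \<le> norm (f \<xi>) * exp ((d - 1) * t)" for \<xi>
  proof -
    have "Re (fourier (\<lambda>x. of_real (J x)) \<xi>) \<le> 1"
      using norm_fourier_prob_kernel_le [OF J, of \<xi>] complex_Re_le_cmod order_trans by blast
    then have "t * (d * Re (fourier (\<lambda>x. of_real (J x)) \<xi>) - 1) \<le> t * (d * 1 - 1)"
      using d t by (intro mult_left_mono diff_right_mono) auto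
    then show ?thesis
      by (simp add: solution_hat_def norm_mult norm_exp_eq_Re mult.commute mult_left_mono)
  qed
  \<comment> \<open>Only the majorant has to be integrable: it is nonnegative, and a non-integrable
    function has integral 0 by convention.\<close>
  then have "(LINT \<xi>|lborel. norm (solution_hat d J f t \<xi>)) \<le> (LINT \<xi>|lborel. norm (f \<xi>) * exp ((d - 1) * t))"
    using f by (intro integral_mono') auto
  moreover have "norm (solution d J f t x) \<le> (LINT \<xi>|lborel. norm (solution_hat d J f t \<xi>))"
    unfolding solution_def inv_fourier_def
    using integral_norm_bound [of lborel "\<lambda>\<xi>. solution_hat d J f t \<xi> * exp (2 * pi * \<i> * x * \<xi>)"]
    by (simp only: norm_mult norm_exp_character mult_1_right)
  ultimately show ?thesis
    by (simp add: L1_norm_def)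
qed

text \<open>
  Expanding \<open>exp (t * d * gaussian s \<xi>)\<close> into its power series turns the solution into a
  superposition, with nonnegative weights, of Gaussians of variance parameter \<open>1 + n * s\<close>.
\<close>

lemma solution_gaussian_sums:
  fixes d s t x :: real
  assumes d: "0 < d" and s: "0 < s" and t: "0 < t"
  shows "(\<lambda>n. complex_of_real (exp (- t) * (t * d) ^ n / fact n *
            (gaussian (inverse (1 + n * s)) x / sqrt (1 + n * s))))
    sums solution d (gaussian_kernel s) (\<lambda>\<xi>. of_real (gaussian 1 \<xi>)) t x"
proof -
  define w where "w n = exp (- t) * (t * d) ^ n / fact n" for n
  define a where "a n = 1 + real n * s" for n
  have a: "1 \<le> a n" "0 < a n" for n
    using s by (auto simp: a_def add_pos_nonneg)
  have w: "0 \<le> w n" for n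
    using d t by (simp add: w_def)
  have w_summable: "summable w"
    using summable_mult [OF summable_exp [of "t * d"], of "exp (- t)"]
    by (simp add: w_def [abs_def] field_simps)
  define F where "F n \<xi> = of_real (w n) * (of_real (gaussian (a n) \<xi>) * exp (2 * pi * \<i> * x * \<xi>))"
    for n and \<xi> :: real
  have norm_F: "norm (F n \<xi>) = w n * gaussian (a n) \<xi>" for n \<xi>
    using w [of n] by (simp add: F_def norm_mult norm_exp_character less_imp_le del: of_real_mult)
  \<comment> \<open>Parameters add under multiplication, so each term of the exponential series
    times the initial value is again a Gaussian.\<close>
  have gaussian_pow: "gaussian (a n) \<xi> = gaussian 1 \<xi> * gaussian s \<xi> ^ n" for n \<xi>
    by (simp add: gaussian_def a_def exp_of_nat_mult [symmetric] exp_add [symmetric] algebra_simps)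
  have F_sums: "(\<lambda>n. F n \<xi>) sums
      (solution_hat d (gaussian_kernel s) (\<lambda>\<xi>. of_real (gaussian 1 \<xi>)) t \<xi> * exp (2 * pi * \<i> * x * \<xi>))" for \<xi>
  proof -
    let ?C = "exp (- t) * gaussian 1 \<xi>"
    have "(\<lambda>n. (t * d * gaussian s \<xi>) ^ n /\<^sub>R fact n) sums exp (t * d * gaussian s \<xi>)"
      by (rule exp_converges)
    then have "(\<lambda>n. ?C * ((t * d * gaussian s \<xi>) ^ n /\<^sub>R fact n)) sums (?C * exp (t * d * gaussian s \<xi>))"
      by (rule sums_mult)
    moreover have "?C * ((t * d * gaussian s \<xi>) ^ n /\<^sub>R fact n) = w n * gaussian (a n) \<xi>" for n
      by (simp add: w_def gaussian_pow power_mult_distrib field_simps)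
    moreover have "?C * exp (t * d * gaussian s \<xi>) = exp (t * (d * gaussian s \<xi> - 1)) * gaussian 1 \<xi>"
      by (simp add: exp_add [symmetric] algebra_simps mult_exp_exp flip: exp_minus)
    ultimately have "(\<lambda>n. w n * gaussian (a n) \<xi>) sums (exp (t * (d * gaussian s \<xi> - 1)) * gaussian 1 \<xi>)"
      by simp
    then have "(\<lambda>n. complex_of_real (w n * gaussian (a n) \<xi>) * exp (2 * pi * \<i> * x * \<xi>)) sums
      (of_real (exp (t * (d * gaussian s \<xi> - 1)) * gaussian 1 \<xi>) * exp (2 * pi * \<i> * x * \<xi>))"
      by (intro sums_mult2) (simp only: sums_of_real_iff)
    then show ?thesis
      by (simp add: F_def solution_hat_def fourier_gaussian_kernel [OF s] mult.assoc flip: exp_of_real)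
  qed
  \<comment> \<open>Termwise integration: since \<open>a n \<ge> 1\<close>, both
    \<open>gaussian (a n) \<xi>\<close> and its integral \<open>1 / sqrt (a n)\<close> are at most
    1, so \<open>w\<close> dominates both series that have to converge.\<close>
  have "(\<lambda>n. integral\<^sup>L lborel (F n)) sums (LINT \<xi>|lborel. (\<Sum>n. F n \<xi>))"
  proof (rule sums_integral)
    show "integrable lborel (F n)" for n
      unfolding F_def [abs_def]
    proof (intro integrable_mult_right integrable_mult_bounded)
      show "integrable lborel (\<lambda>\<xi>. complex_of_real (gaussian (a n) \<xi>))"
        using integrable_gaussian [OF a(2)] by simp
      show "norm (exp (2 * pi * \<i> * complex_of_real x * complex_of_real \<xi>)) \<le> 1" for \<xi>
        by (simp only: norm_exp_character order_refl)
    qed measurable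
    have "summable (\<lambda>n. norm (F n \<xi>))" for \<xi>
    proof (rule summable_comparison_test' [OF w_summable])
      show "norm (norm (F n \<xi>)) \<le> w n" for n
        using w [of n] a [of n]
        by (simp add: norm_F mult_left_le gaussian_def less_imp_le)
    qed
    then show "AE \<xi> in lborel. summable (\<lambda>n. norm (F n \<xi>))"
      by simp
    show "summable (\<lambda>n. LINT \<xi>|lborel. norm (F n \<xi>))"
    proof (rule summable_comparison_test' [OF w_summable])
      show "norm (LINT \<xi>|lborel. norm (F n \<xi>)) \<le> w n" for n
        using w [of n] a [of n] divide_left_mono [of 1 "sqrt (a n)" "w n"]
        by (simp add: norm_F integral_gaussian)
    qed
  qed
  moreover have "(LINT \<xi>|lborel. (\<Sum>n. F n \<xi>))
    = solution d (gaussian_kernel s) (\<lambda>\<xi>. of_real (gaussian 1 \<xi>)) t x"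
    unfolding solution_def inv_fourier_def using F_sums by (simp add: sums_iff)
  moreover have "integral\<^sup>L lborel (F n) = of_real (w n * (gaussian (inverse (a n)) x / sqrt (a n)))" for n
    using inv_fourier_gaussian [OF a(2), of n x] by (simp add: F_def [abs_def] inv_fourier_def)
  ultimately show ?thesis
    by (simp only: w_def a_def)
qed

text \<open>The terms of the series are nonnegative, so it can be bounded below term by term; the
  lower bounds again form an exponential series.\<close>

lemma norm_solution_gaussian_ge:
  fixes d s t x :: real
  assumes d: "0 < d" and s: "0 < s" and t: "0 < t"
  shows "gaussian 1 x * exp ((d - 1 - d * s / 2) * t)
    \<le> norm (solution d (gaussian_kernel s) (\<lambda>\<xi>. of_real (gaussian 1 \<xi>)) t x)"
    (is "_ \<le> norm ?u")
proof -
  define w where "w n = exp (- t) * (t * d) ^ n / fact n" for n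
  define r where "r n = w n * (gaussian (inverse (1 + n * s)) x / sqrt (1 + n * s))" for n
  have "(\<lambda>n. complex_of_real (r n)) sums ?u"
    using solution_gaussian_sums [OF assms, of x] by (simp add: r_def w_def)
  \<comment> \<open>The terms are real; passing to the real part makes the order on the reals
    available for comparing sums.\<close>
  then have r_sums: "r sums Re ?u"
    using sums_Re by fastforce
  have w: "0 \<le> w n" for n
    using d t by (simp add: w_def)
  have "gaussian 1 x * w n * exp (- s / 2) ^ n \<le> r n" for n
  proof -
    let ?a = "1 + real n * s"
    have a: "1 \<le> ?a"
      using s by simp
    \<comment> \<open>The polynomial decay of the peak is replaced by the geometric bound
      \<open>exp (- s / 2) ^ n\<close>, which fits into the exponential series.\<close>
    have "sqrt ?a \<le> exp (n * s / 2)"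
    proof (rule real_le_lsqrt)
      have "?a \<le> exp (n * s)"
        by (rule exp_ge_add_one_self)
      also have "\<dots> = (exp (n * s / 2))\<^sup>2"
        by (simp add: exp_double [symmetric])
      finally show "?a \<le> (exp (n * s / 2))\<^sup>2" .
    qed simp
    then have "exp (- s / 2) ^ n \<le> 1 / sqrt ?a"
      using a by (simp add: exp_of_nat_mult [symmetric] exp_minus field_simps)
    moreover have "inverse ?a * x\<^sup>2 \<le> 1 * x\<^sup>2"
      using a by (intro mult_right_mono) (auto simp: inverse_le_1_iff)
    then have "gaussian 1 x \<le> gaussian (inverse ?a) x"
      by (simp add: gaussian_def mult.assoc)
    ultimately have "gaussian 1 x * exp (- s / 2) ^ n \<le> gaussian (inverse ?a) x * (1 / sqrt ?a)"
      by (intro mult_mono) (auto simp: less_imp_le)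
    then show ?thesis
      using mult_left_mono [OF _ w [of n]] by (fastforce simp: r_def mult_ac)
  qed
  moreover have "(\<lambda>n. gaussian 1 x * w n * exp (- s / 2) ^ n) sums
    (gaussian 1 x * (exp (- t) * exp (t * d * exp (- s / 2))))"
  proof -
    have "gaussian 1 x * w n * exp (- s / 2) ^ n
      = gaussian 1 x * (exp (- t) * ((t * d * exp (- s / 2)) ^ n /\<^sub>R fact n))" for n
      unfolding w_def power_mult_distrib [of "t * d"] scaleR_conv_of_real
      by (simp only: of_real_inverse of_real_fact divide_inverse mult_ac)
    then show ?thesis
      by (simp only:) (intro sums_mult exp_converges)
  qed
  ultimately have "gaussian 1 x * (exp (- t) * exp (t * d * exp (- s / 2))) \<le> Re ?u"
    using r_sums by (rule sums_le)
  also have "\<dots> \<le> norm ?u"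
    by (rule complex_Re_le_cmod)
  finally have "gaussian 1 x * (exp (- t) * exp (t * d * exp (- s / 2))) \<le> norm ?u" .
  moreover have "exp ((d - 1 - d * s / 2) * t) \<le> exp (- t) * exp (t * d * exp (- s / 2))"
  proof -
    \<comment> \<open>The tangent at 0 makes the loss in the rate linear in
      \<open>s\<close>.\<close>
    have "1 - s / 2 \<le> exp (- s / 2)"
      using exp_ge_add_one_self [of "- s / 2"] by simp
    then have "t * d * (1 - s / 2) \<le> t * d * exp (- s / 2)"
      using d t by (intro mult_left_mono) auto
    then show ?thesis
      by (simp add: mult_exp_exp algebra_simps)
  qed
  ultimately show ?thesis
    by (meson gaussian_pos less_imp_le mult_left_mono order_trans)
qed

theorem theorem1:
  "(\<forall>(d::real) J u0 u0_hat. d > 0 \<longrightarrow> prob_kernel J \<longrightarrow> has_L1_fourier u0 u0_hat \<longrightarrow>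
      (\<forall>t>0. \<forall>x. norm (solution d J u0_hat t x) \<le> L1_norm u0_hat * exp ((d - 1) * t)))
   \<and>
   (\<exists>g h :: functional \<Rightarrow> real \<Rightarrow> real.
      (\<forall>u0 x. 0 < g u0 x \<and> 0 < h u0 x) \<and>
      (\<forall>u0 v0. dist_eq u0 v0 \<longrightarrow> g u0 = g v0 \<and> h u0 = h v0) \<and>
      (\<forall>(d::real) \<epsilon>::real. d > 0 \<longrightarrow> \<epsilon> > 0 \<longrightarrow>
         (\<exists>J u0 u0_hat. prob_kernel J \<and> has_L1_fourier u0 u0_hat \<and>
            (\<forall>t>0. \<forall>x.
               g u0 x * exp ((d - 1 - \<epsilon>) * t) < norm (solution d J u0_hat t x) \<and>
               norm (solution d J u0_hat t x) < h u0 x * exp ((d - 1) * t)))))"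
proof (rule conjI; (rule exI [of _ "\<lambda>_ x. gaussian 1 x / 2"], rule exI [of _ "\<lambda>_ _. 2"])?;
    intro conjI allI impI)
  fix d :: real and J u0 u0_hat and t x :: real
  assume "d > 0" "prob_kernel J" "has_L1_fourier u0 u0_hat" "t > 0"
  then show "norm (solution d J u0_hat t x) \<le> L1_norm u0_hat * exp ((d - 1) * t)"
    by (intro norm_solution_le) (auto simp: has_L1_fourier_def)
next
  fix d \<epsilon> :: real
  assume d: "d > 0" and \<epsilon>: "\<epsilon> > 0"
  \<comment> \<open>Chosen so that the loss \<open>d * s / 2\<close> in the rate is exactly
    \<open>\<epsilon>\<close>.\<close>
  define s where "s = 2 * \<epsilon> / d"
  have s: "0 < s" "d * s / 2 = \<epsilon>"
    using d \<epsilon> by (simp_all add: s_def)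
  let ?f = "\<lambda>x. complex_of_real (gaussian 1 x)"
  \<comment> \<open>The Gaussian with parameter 1 is its own Fourier transform, so it represents
    both the initial value and \<open>u0_hat\<close>.\<close>
  have f: "integrable lborel ?f" "fourier ?f = ?f"
    using integrable_gaussian [of 1] inv_fourier_gaussian [of 1]
    by (simp_all add: fun_eq_iff fourier_conv_inv_fourier) (simp add: gaussian_def)
  have "L1_norm ?f = 1"
    by (simp add: L1_norm_def integral_gaussian less_imp_le)
  show "\<exists>J u0 u0_hat. prob_kernel J \<and> has_L1_fourier u0 u0_hat \<and>
    (\<forall>t>0. \<forall>x. gaussian 1 x / 2 * exp ((d - 1 - \<epsilon>) * t) < norm (solution d J u0_hat t x) \<and>
      norm (solution d J u0_hat t x) < 2 * exp ((d - 1) * t))"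
  proof (intro exI conjI allI impI)
    show J: "prob_kernel (gaussian_kernel s)"
      using s(1) by (rule prob_kernel_gaussian_kernel)
    show "has_L1_fourier (dist_of_fun ?f) ?f"
      using has_L1_fourier_dist_of_fun [of ?f] f by simp
    fix t x :: real assume t: "t > 0"
    \<comment> \<open>The factor 1/2 in \<open>g\<close>, like the value 2 of \<open>h\<close>
      against \<open>L1_norm ?f = 1\<close>, turns the weak bounds into strict ones.\<close>
    have "gaussian 1 x / 2 * exp ((d - 1 - \<epsilon>) * t) < gaussian 1 x * exp ((d - 1 - \<epsilon>) * t)"
      by simp
    also have "\<dots> \<le> norm (solution d (gaussian_kernel s) ?f t x)"
      using norm_solution_gaussian_ge [OF d s(1) t, of x] by (simp only: s(2))
    finally show "gaussian 1 x / 2 * exp ((d - 1 - \<epsilon>) * t) < norm (solution d (gaussian_kernel s) ?f t x)" .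
    have "norm (solution d (gaussian_kernel s) ?f t x) \<le> 1 * exp ((d - 1) * t)"
      using norm_solution_le [OF _ J f(1), of d t x] d t \<open>L1_norm ?f = 1\<close> by simp
    also have "\<dots> < 2 * exp ((d - 1) * t)"
      by simp
    finally show "norm (solution d (gaussian_kernel s) ?f t x) < 2 * exp ((d - 1) * t)" .
  qed
qed (auto simp: less_imp_le)

end
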